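(* Let $\Bbbk$ be an arbitrary field and let $L$ be a finite-dimensional Lie double algebra over $\Bbbk$ with $\dim L>1$. Then $L$ contains a nonzero proper ideal.
   Context: A double algebra over a field $\Bbbk$ is a linear space $V$ with a linear map (double bracket) $V\otimes V\to V\otimes V$, $a\otimes b\mapsto \{\!\{a,b\}\!\}$. An ideal of $V$ is a subspace $I\subseteq V$ such that $\{\!\{v,w\}\!\}\in I\otimes V+V\otimes I$ whenever $v\in I$, $w\in V$ or $v\in V$, $w\in I$; it is proper if $I\neq V$. For $u\in V^{\otimes n}$ and $\sigma\in S_n$, $u^\sigma$ denotes the result of permuting the tensor factors of $u$ by $\sigma$ (e.g. $u^{(12)}$ interchanges the first two factors). The double bracket is extended linearly to four maps $V^{\otimes 3}\to V^{\otimes 3}$ by $\{\!\{a,b\otimes c\}\!\}_L=\{\!\{a,b\}\!\}\otimes c$, $\{\!\{a,b\otimes c\}\!\}_R=(b\otimes\{\!\{a,c\}\!\})^{(12)}$, $\{\!\{a\otimes b,c\}\!\}_L=(\{\!\{a,c\}\!\}\otimes b)^{(23)}$, $\{\!\{a\otimes b,c\}\!\}_R=a\otimes\{\!\{b,c\}\!\}$. A double algebra $L$ is a Lie double algebra if for all $a,b,c\in L$: $\{\!\{a,b\}\!\}=-\{\!\{b,a\}\!\}^{(12)}$ and $\{\!\{a,\{\!\{b,c\}\!\}\}\!\}_L-\{\!\{b,\{\!\{a,c\}\!\}\}\!\}_R^{(12)}=\{\!\{\{\!\{a,b\}\!\},c\}\!\}_L$. *)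

theory Defs
  imports Complex_Main "HOL-Library.Function_Algebras"
begin

text \<open>
  A vector space is a type with a scalar multiplication (locale \<^locale>\<open>vector_space\<close>).  Its tensor
  powers are realised inside spaces of functionals on multilinear forms: the pure tensor of \<open>v\<close>
  and \<open>w\<close> is the functional that evaluates a bilinear form at \<open>(v, w)\<close>, and the tensor square is the
  linear span of the pure tensors.  Functionals are defined on all functions of two (three)
  arguments, with value \<open>0\<close> on those that are not multilinear, so that equality of tensors is
  equality in HOL.  In arbitrary dimension, every multilinear map extends linearly to the tensor
  power (\<open>tensor2_universal\<close>, \<open>tensor3_universal\<close>), uniquely so because pure tensors span it.
\<close>

definition fscale :: "'k::field \<Rightarrow> ('s \<Rightarrow> 'k) \<Rightarrow> 's \<Rightarrow> 'k" where
  "fscale c u = (\<lambda>s. c * u s)"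

lemma vector_space_fscale: "vector_space fscale"
  by unfold_locales (auto simp: fscale_def algebra_simps fun_eq_iff)

lemma vector_space_field: "vector_space ((*) :: 'k::field \<Rightarrow> 'k \<Rightarrow> 'k)"
  by unfold_locales (auto simp: algebra_simps)

lemma span_universal:
  fixes ev :: "'x \<Rightarrow> 's \<Rightarrow> 'k::field" and f :: "'x \<Rightarrow> 'w::ab_group_add"
  assumes s: "vector_space s"
    and ev: "\<And>\<phi>. Vector_Spaces.linear s (*) \<phi> \<Longrightarrow> \<exists>t. \<forall>x. ev x t = \<phi> (f x)"
  shows "\<exists>g. Vector_Spaces.linear fscale s g \<and> (\<forall>x. g (ev x) = f x)"
proof -
  interpret F: vector_space fscale by (rule vector_space_fscale)
  interpret W: vector_space s by (rule s)
  interpret K: vector_space "(*) :: 'k \<Rightarrow> 'k \<Rightarrow> 'k" by (rule vector_space_field)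
  interpret FW: vector_space_pair fscale s by unfold_locales
  interpret WK: vector_space_pair s "(*) :: 'k \<Rightarrow> 'k \<Rightarrow> 'k" by unfold_locales
  interpret FK: vector_space_pair fscale "(*) :: 'k \<Rightarrow> 'k \<Rightarrow> 'k" by unfold_locales
  obtain B where B: "B \<subseteq> range ev" "F.independent B" "range ev \<subseteq> F.span B"
    using F.maximal_independent_subset by blast
  obtain p where p: "\<And>b. b \<in> B \<Longrightarrow> ev (p b) = b"
    using B(1) by (metis f_inv_into_f subsetD)
  obtain g where g: "Vector_Spaces.linear fscale s g" "\<And>b. b \<in> B \<Longrightarrow> g b = f (p b)"
    using FW.linear_independent_extend[OF B(2), of "f \<circ> p"] by auto
  have "g (ev x) = f x" for x
  proof (rule ccontr)
    assume "g (ev x) \<noteq> f x"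
    then have "g (ev x) - f x \<noteq> 0" by simp
    then have "W.independent {g (ev x) - f x}" by simp
    then obtain \<phi> where \<phi>: "Vector_Spaces.linear s (*) \<phi>" "\<phi> (g (ev x) - f x) = 1"
      using WK.linear_independent_extend[of "{g (ev x) - f x}" "\<lambda>_. 1"] by auto
    obtain t where t: "\<And>x. ev x t = \<phi> (f x)" using ev[OF \<phi>(1)] by blast
    have "\<phi> (g (ev x)) = ev x t"
    proof (rule FK.linear_eq_on[where f = "\<phi> \<circ> g" and g = "\<lambda>u. u t" and B = B, simplified])
      show "Vector_Spaces.linear fscale (*) (\<phi> \<circ> g)"
        by (rule Vector_Spaces.linear_compose[OF g(1) \<phi>(1)])
      show "Vector_Spaces.linear fscale (*) (\<lambda>u :: 's \<Rightarrow> 'k. u t)"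
        using F.vector_space_axioms K.vector_space_axioms
        by (simp add: Vector_Spaces.linear_iff fscale_def)
      show "ev x \<in> F.span B" using B(3) by auto
      show "\<phi> (g b) = b t" if "b \<in> B" for b
        using t[of "p b"] that by (simp add: g(2) p)
    qed
    with t[of x] \<phi> show False
      by (simp add: WK.linear_diff)
  qed
  with g(1) show ?thesis by blast
qed

locale tensor_powers = vector_space scale
  for scale :: "'a::field \<Rightarrow> 'b::ab_group_add \<Rightarrow> 'b" (infixr \<open>*s\<close> 75)
begin

definition bilinear_map :: "('a \<Rightarrow> 'w \<Rightarrow> 'w::ab_group_add) \<Rightarrow> ('b \<Rightarrow> 'b \<Rightarrow> 'w) \<Rightarrow> bool" where
  "bilinear_map s f \<longleftrightarrow>
     (\<forall>y. Vector_Spaces.linear scale s (\<lambda>x. f x y)) \<and>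
     (\<forall>x. Vector_Spaces.linear scale s (\<lambda>y. f x y))"

definition trilinear_map ::
  "('a \<Rightarrow> 'w \<Rightarrow> 'w::ab_group_add) \<Rightarrow> ('b \<Rightarrow> 'b \<Rightarrow> 'b \<Rightarrow> 'w) \<Rightarrow> bool" where
  "trilinear_map s f \<longleftrightarrow>
     (\<forall>y z. Vector_Spaces.linear scale s (\<lambda>x. f x y z)) \<and>
     (\<forall>x z. Vector_Spaces.linear scale s (\<lambda>y. f x y z)) \<and>
     (\<forall>x y. Vector_Spaces.linear scale s (\<lambda>z. f x y z))"

definition pure2 :: "'b \<Rightarrow> 'b \<Rightarrow> ('b \<Rightarrow> 'b \<Rightarrow> 'a) \<Rightarrow> 'a" where
  "pure2 v w = (\<lambda>B. if bilinear_map (*) B then B v w else 0)"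

definition pure3 :: "'b \<Rightarrow> 'b \<Rightarrow> 'b \<Rightarrow> ('b \<Rightarrow> 'b \<Rightarrow> 'b \<Rightarrow> 'a) \<Rightarrow> 'a" where
  "pure3 u v w = (\<lambda>T. if trilinear_map (*) T then T u v w else 0)"

text \<open>For subspaces \<open>I\<close> and \<open>J\<close>, \<open>tensor_set I J\<close> is the subspace \<open>I \<otimes> J\<close> of \<open>V \<otimes> V\<close>.\<close>

definition tensor_set :: "'b set \<Rightarrow> 'b set \<Rightarrow> (('b \<Rightarrow> 'b \<Rightarrow> 'a) \<Rightarrow> 'a) set" where
  "tensor_set I J = module.span fscale {pure2 v w | v w. v \<in> I \<and> w \<in> J}"

abbreviation tensor2 :: "(('b \<Rightarrow> 'b \<Rightarrow> 'a) \<Rightarrow> 'a) set" where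
  "tensor2 \<equiv> tensor_set UNIV UNIV"

definition tensor3 :: "(('b \<Rightarrow> 'b \<Rightarrow> 'b \<Rightarrow> 'a) \<Rightarrow> 'a) set" where
  "tensor3 = module.span fscale {pure3 u v w | u v w. True}"

text \<open>
  The operations below are characterised by their values on pure tensors, see the lemmas
  \<open>swap_pure2\<close>, \<open>perm12_pure3\<close>, \<open>perm23_pure3\<close>, \<open>rtensor_pure2\<close>, \<open>ltensor_pure2\<close>, \<open>ext_pure2\<close>.
\<close>

definition swap :: "(('b \<Rightarrow> 'b \<Rightarrow> 'a) \<Rightarrow> 'a) \<Rightarrow> ('b \<Rightarrow> 'b \<Rightarrow> 'a) \<Rightarrow> 'a" where
  "swap u = (\<lambda>B. u (\<lambda>x y. B y x))"

definition perm12 :: "(('b \<Rightarrow> 'b \<Rightarrow> 'b \<Rightarrow> 'a) \<Rightarrow> 'a) \<Rightarrow> ('b \<Rightarrow> 'b \<Rightarrow> 'b \<Rightarrow> 'a) \<Rightarrow> 'a" where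
  "perm12 u = (\<lambda>T. u (\<lambda>x y z. T y x z))"

definition perm23 :: "(('b \<Rightarrow> 'b \<Rightarrow> 'b \<Rightarrow> 'a) \<Rightarrow> 'a) \<Rightarrow> ('b \<Rightarrow> 'b \<Rightarrow> 'b \<Rightarrow> 'a) \<Rightarrow> 'a" where
  "perm23 u = (\<lambda>T. u (\<lambda>x y z. T x z y))"

definition rtensor :: "(('b \<Rightarrow> 'b \<Rightarrow> 'a) \<Rightarrow> 'a) \<Rightarrow> 'b \<Rightarrow> ('b \<Rightarrow> 'b \<Rightarrow> 'b \<Rightarrow> 'a) \<Rightarrow> 'a" where
  "rtensor u c = (\<lambda>T. if trilinear_map (*) T then u (\<lambda>x y. T x y c) else 0)"

definition ltensor :: "'b \<Rightarrow> (('b \<Rightarrow> 'b \<Rightarrow> 'a) \<Rightarrow> 'a) \<Rightarrow> ('b \<Rightarrow> 'b \<Rightarrow> 'b \<Rightarrow> 'a) \<Rightarrow> 'a" where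
  "ltensor b u = (\<lambda>T. if trilinear_map (*) T then u (\<lambda>x y. T b x y) else 0)"

text \<open>The linear extension of a bilinear map \<open>f\<close> to \<open>V \<otimes> V\<close>.\<close>

definition ext :: "('b \<Rightarrow> 'b \<Rightarrow> 's \<Rightarrow> 'a) \<Rightarrow> (('b \<Rightarrow> 'b \<Rightarrow> 'a) \<Rightarrow> 'a) \<Rightarrow> 's \<Rightarrow> 'a" where
  "ext f u = (\<lambda>t. u (\<lambda>x y. f x y t))"

theorem tensor2_universal:
  assumes s: "vector_space s" and f: "bilinear_map s f"
  shows "\<exists>g. Vector_Spaces.linear fscale s g \<and> (\<forall>v w. g (pure2 v w) = f v w)"
proof -
  have "\<exists>g. Vector_Spaces.linear fscale s g \<and>
      (\<forall>x. g ((\<lambda>(v, w). pure2 v w) x) = (\<lambda>(v, w). f v w) x)"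
  proof (rule span_universal[OF s])
    fix \<phi> assume \<phi>: "Vector_Spaces.linear s (*) \<phi>"
    have "bilinear_map (*) (\<lambda>v w. \<phi> (f v w))"
      using f unfolding bilinear_map_def
      by (intro conjI allI Vector_Spaces.linear_compose[OF _ \<phi>, unfolded o_def]) blast+
    then show "\<exists>t. \<forall>x. (\<lambda>(v, w). pure2 v w) x t = \<phi> ((\<lambda>(v, w). f v w) x)"
      by (auto simp: pure2_def intro!: exI[of _ "\<lambda>v w. \<phi> (f v w)"])
  qed
  then show ?thesis by auto
qed

theorem tensor3_universal:
  assumes s: "vector_space s" and f: "trilinear_map s f"
  shows "\<exists>g. Vector_Spaces.linear fscale s g \<and> (\<forall>u v w. g (pure3 u v w) = f u v w)"
proof -
  have "\<exists>g. Vector_Spaces.linear fscale s g \<and>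
      (\<forall>x. g ((\<lambda>(u, v, w). pure3 u v w) x) = (\<lambda>(u, v, w). f u v w) x)"
  proof (rule span_universal[OF s])
    fix \<phi> assume \<phi>: "Vector_Spaces.linear s (*) \<phi>"
    have "trilinear_map (*) (\<lambda>u v w. \<phi> (f u v w))"
      using f unfolding trilinear_map_def
      by (intro conjI allI Vector_Spaces.linear_compose[OF _ \<phi>, unfolded o_def]) blast+
    then show "\<exists>t. \<forall>x. (\<lambda>(u, v, w). pure3 u v w) x t = \<phi> ((\<lambda>(u, v, w). f u v w) x)"
      by (auto simp: pure3_def intro!: exI[of _ "\<lambda>u v w. \<phi> (f u v w)"])
  qed
  then show ?thesis by auto
qed

lemma linear_fscale_iff:
  fixes f :: "'b \<Rightarrow> 's \<Rightarrow> 'a"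
  shows "Vector_Spaces.linear scale fscale f \<longleftrightarrow>
     (\<forall>x y t. f (x + y) t = f x t + f y t) \<and> (\<forall>c x t. f (c *s x) t = c * f x t)"
proof -
  have "vector_space (fscale :: 'a \<Rightarrow> ('s \<Rightarrow> 'a) \<Rightarrow> 's \<Rightarrow> 'a)" by (rule vector_space_fscale)
  then show ?thesis
    using vector_space_axioms by (auto simp: Vector_Spaces.linear_iff fscale_def fun_eq_iff)
qed

lemma linear_field_iff:
  "Vector_Spaces.linear scale (*) f \<longleftrightarrow>
     (\<forall>x y. f (x + y) = f x + f y) \<and> (\<forall>c x. f (c *s x) = c * f x)"
proof -
  have "vector_space ((*) :: 'a \<Rightarrow> 'a \<Rightarrow> 'a)" by (rule vector_space_field)
  then show ?thesis using vector_space_axioms by (simp add: Vector_Spaces.linear_iff)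
qed

lemma bilinear_pure2: "bilinear_map fscale pure2"
  unfolding bilinear_map_def linear_fscale_iff pure2_def by (auto simp: bilinear_map_def linear_field_iff)

lemma trilinear_pure3: "trilinear_map fscale pure3"
  unfolding trilinear_map_def linear_fscale_iff pure3_def
  by (auto simp: trilinear_map_def linear_field_iff)

lemma trilinear_perm:
  "trilinear_map (*) (\<lambda>x y z. T y x z) \<longleftrightarrow> trilinear_map (*) T"
  "trilinear_map (*) (\<lambda>x y z. T x z y) \<longleftrightarrow> trilinear_map (*) T"
  unfolding trilinear_map_def by auto

lemma bilinear_swap: "bilinear_map (*) (\<lambda>x y. B y x) \<longleftrightarrow> bilinear_map (*) B"
  unfolding bilinear_map_def by auto

lemma trilinear_slice:
  assumes "trilinear_map (*) T"
  shows "bilinear_map (*) (\<lambda>x y. T x y z)" "bilinear_map (*) (\<lambda>x y. T z x y)"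
    "bilinear_map (*) (\<lambda>x y. T x z y)"
  using assms unfolding trilinear_map_def bilinear_map_def by auto

lemma pure2_in: "pure2 v w \<in> tensor2"
proof -
  interpret F: vector_space "fscale :: 'a \<Rightarrow> (('b \<Rightarrow> 'b \<Rightarrow> 'a) \<Rightarrow> 'a) \<Rightarrow> _" by (rule vector_space_fscale)
  show ?thesis unfolding tensor_set_def by (rule F.span_base) auto
qed

lemma swap_pure2: "swap (pure2 v w) = pure2 w v"
proof
  show "swap (pure2 v w) T = pure2 w v T" for T
    using bilinear_swap[of T] by (simp add: swap_def pure2_def)
qed

lemma perm12_pure3: "perm12 (pure3 u v w) = pure3 v u w"
proof
  show "perm12 (pure3 u v w) T = pure3 v u w T" for T
    using trilinear_perm(1)[of T] by (simp add: perm12_def pure3_def)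
qed

lemma perm23_pure3: "perm23 (pure3 u v w) = pure3 u w v"
proof
  show "perm23 (pure3 u v w) T = pure3 u w v T" for T
    using trilinear_perm(2)[of T] by (simp add: perm23_def pure3_def)
qed

lemma rtensor_pure2: "rtensor (pure2 x y) c = pure3 x y c"
proof
  show "rtensor (pure2 x y) c T = pure3 x y c T" for T
    using trilinear_slice(1)[of T c] by (simp add: rtensor_def pure2_def pure3_def)
qed

lemma ltensor_pure2: "ltensor b (pure2 x y) = pure3 b x y"
proof
  show "ltensor b (pure2 x y) T = pure3 b x y T" for T
    using trilinear_slice(2)[of T b] by (simp add: ltensor_def pure2_def pure3_def)
qed

lemma perm12_ltensor:
  "perm12 (ltensor b u) = (\<lambda>T. if trilinear_map (*) T then u (\<lambda>x y. T x b y) else 0)"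
proof
  show "perm12 (ltensor b u) T = (if trilinear_map (*) T then u (\<lambda>x y. T x b y) else 0)" for T
    using trilinear_perm(1)[of T] by (simp add: perm12_def ltensor_def)
qed

lemma perm23_rtensor:
  "perm23 (rtensor u b) = (\<lambda>T. if trilinear_map (*) T then u (\<lambda>x y. T x b y) else 0)"
proof
  show "perm23 (rtensor u b) T = (if trilinear_map (*) T then u (\<lambda>x y. T x b y) else 0)" for T
    using trilinear_perm(2)[of T] by (simp add: perm23_def rtensor_def)
qed

lemma ext_pure2: "bilinear_map fscale f \<Longrightarrow> ext f (pure2 v w) = f v w"
  unfolding bilinear_map_def linear_fscale_iff
  by (auto simp: ext_def pure2_def bilinear_map_def linear_field_iff)

lemma tensor_ops_add:
  "swap (p + q) = swap p + swap q" "perm12 (u + v) = perm12 u + perm12 v"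
  "perm23 (u + v) = perm23 u + perm23 v" "rtensor (p + q) c = rtensor p c + rtensor q c"
  "ltensor c (p + q) = ltensor c p + ltensor c q" "ext f (p + q) = ext f p + ext f q"
  by (auto simp: swap_def perm12_def perm23_def rtensor_def ltensor_def ext_def)

lemma tensor_ops_scale:
  "swap (fscale r p) = fscale r (swap p)" "perm12 (fscale r u) = fscale r (perm12 u)"
  "perm23 (fscale r u) = fscale r (perm23 u)" "rtensor (fscale r p) c = fscale r (rtensor p c)"
  "ltensor c (fscale r p) = fscale r (ltensor c p)" "ext f (fscale r p) = fscale r (ext f p)"
  by (auto simp: swap_def perm12_def perm23_def rtensor_def ltensor_def ext_def fscale_def)

lemma tensor2_linear_param:
  assumes u: "u \<in> tensor2" and T: "trilinear_map (*) T"
  shows "Vector_Spaces.linear scale (*) (\<lambda>z. u (\<lambda>x y. T x y z))"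
    "Vector_Spaces.linear scale (*) (\<lambda>z. u (\<lambda>x y. T z x y))"
    "Vector_Spaces.linear scale (*) (\<lambda>z. u (\<lambda>x y. T x z y))"
proof -
  interpret F: vector_space "fscale :: 'a \<Rightarrow> (('b \<Rightarrow> 'b \<Rightarrow> 'a) \<Rightarrow> 'a) \<Rightarrow> _" by (rule vector_space_fscale)
  have "Vector_Spaces.linear scale (*) (\<lambda>z. u (\<lambda>x y. T x y z)) \<and>
    Vector_Spaces.linear scale (*) (\<lambda>z. u (\<lambda>x y. T z x y)) \<and>
    Vector_Spaces.linear scale (*) (\<lambda>z. u (\<lambda>x y. T x z y))"
    using u unfolding tensor_set_def
  proof (induction rule: F.span_induct_alt)
    case base
    show ?case by (simp add: linear_field_iff)
  next
    case (step c p u)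
    then obtain v w where "p = pure2 v w" by auto
    then have "p (\<lambda>x y. T x y z) = T v w z" "p (\<lambda>x y. T z x y) = T z v w"
      "p (\<lambda>x y. T x z y) = T v z w" for z
      using trilinear_slice[OF T, of z] by (simp_all add: pure2_def)
    with step.IH T show ?case
      by (simp add: trilinear_map_def linear_field_iff fscale_def algebra_simps)
  qed
  then show "Vector_Spaces.linear scale (*) (\<lambda>z. u (\<lambda>x y. T x y z))"
    "Vector_Spaces.linear scale (*) (\<lambda>z. u (\<lambda>x y. T z x y))"
    "Vector_Spaces.linear scale (*) (\<lambda>z. u (\<lambda>x y. T x z y))" by auto
qed

end

locale double_algebra = tensor_powers scale
  for scale :: "'k::field \<Rightarrow> 'v::ab_group_add \<Rightarrow> 'v" +
  fixes br :: "(('v \<Rightarrow> 'v \<Rightarrow> 'k) \<Rightarrow> 'k) \<Rightarrow> ('v \<Rightarrow> 'v \<Rightarrow> 'k) \<Rightarrow> 'k"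
    \<comment> \<open>a linear map from \<open>V \<otimes> V\<close> to itself; its values outside \<open>V \<otimes> V\<close> are irrelevant\<close>
  assumes br_in: "u \<in> tensor2 \<Longrightarrow> br u \<in> tensor2"
    and br_add: "u \<in> tensor2 \<Longrightarrow> v \<in> tensor2 \<Longrightarrow> br (u + v) = br u + br v"
    and br_scale: "u \<in> tensor2 \<Longrightarrow> br (fscale c u) = fscale c (br u)"
begin

definition bracket :: "'v \<Rightarrow> 'v \<Rightarrow> ('v \<Rightarrow> 'v \<Rightarrow> 'k) \<Rightarrow> 'k" (\<open>\<lbrace>_, _\<rbrace>\<close>) where
  "\<lbrace>a, b\<rbrace> = br (pure2 a b)"

definition double_ideal :: "'v set \<Rightarrow> bool" where
  "double_ideal I \<longleftrightarrow> subspace I \<and>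
     (\<forall>v w. v \<in> I \<or> w \<in> I \<longrightarrow>
        \<lbrace>v, w\<rbrace> \<in> {p + q | p q. p \<in> tensor_set I UNIV \<and> q \<in> tensor_set UNIV I})"

text \<open>The suffix \<open>_vt\<close> is for a vector and a tensor as arguments, \<open>_tv\<close> for a tensor and a vector.\<close>

definition bracketL_vt :: "'v \<Rightarrow> (('v \<Rightarrow> 'v \<Rightarrow> 'k) \<Rightarrow> 'k) \<Rightarrow> ('v \<Rightarrow> 'v \<Rightarrow> 'v \<Rightarrow> 'k) \<Rightarrow> 'k" where
  "bracketL_vt a u = ext (\<lambda>b c. rtensor \<lbrace>a, b\<rbrace> c) u"

definition bracketR_vt :: "'v \<Rightarrow> (('v \<Rightarrow> 'v \<Rightarrow> 'k) \<Rightarrow> 'k) \<Rightarrow> ('v \<Rightarrow> 'v \<Rightarrow> 'v \<Rightarrow> 'k) \<Rightarrow> 'k" where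
  "bracketR_vt a u = ext (\<lambda>b c. perm12 (ltensor b \<lbrace>a, c\<rbrace>)) u"

definition bracketL_tv :: "(('v \<Rightarrow> 'v \<Rightarrow> 'k) \<Rightarrow> 'k) \<Rightarrow> 'v \<Rightarrow> ('v \<Rightarrow> 'v \<Rightarrow> 'v \<Rightarrow> 'k) \<Rightarrow> 'k" where
  "bracketL_tv u c = ext (\<lambda>a b. perm23 (rtensor \<lbrace>a, c\<rbrace> b)) u"

definition bracketR_tv :: "(('v \<Rightarrow> 'v \<Rightarrow> 'k) \<Rightarrow> 'k) \<Rightarrow> 'v \<Rightarrow> ('v \<Rightarrow> 'v \<Rightarrow> 'v \<Rightarrow> 'k) \<Rightarrow> 'k" where
  "bracketR_tv u c = ext (\<lambda>a b. ltensor a \<lbrace>b, c\<rbrace>) u"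

lemma bracket_in: "\<lbrace>a, b\<rbrace> \<in> tensor2"
  by (simp add: bracket_def br_in pure2_in)

lemma bilinear_bracket: "bilinear_map fscale bracket"
proof -
  have lin: "pure2 (x + y) z = pure2 x z + pure2 y z" "pure2 z (x + y) = pure2 z x + pure2 z y"
    "pure2 (scale c x) z = fscale c (pure2 x z)" "pure2 z (scale c x) = fscale c (pure2 z x)"
    for x y z c
    using bilinear_pure2 by (auto simp: bilinear_map_def Vector_Spaces.linear_iff)
  show ?thesis
    using vector_space_fscale vector_space_axioms
    by (simp add: bilinear_map_def Vector_Spaces.linear_iff bracket_def lin br_add br_scale pure2_in)
qed

lemma bracket_linear:
  "\<lbrace>x + y, z\<rbrace> = \<lbrace>x, z\<rbrace> + \<lbrace>y, z\<rbrace>" "\<lbrace>z, x + y\<rbrace> = \<lbrace>z, x\<rbrace> + \<lbrace>z, y\<rbrace>"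
  "\<lbrace>scale c x, z\<rbrace> = fscale c \<lbrace>x, z\<rbrace>" "\<lbrace>z, scale c x\<rbrace> = fscale c \<lbrace>z, x\<rbrace>"
  using bilinear_bracket by (auto simp: bilinear_map_def Vector_Spaces.linear_iff)

lemma bracketL_vt_pure2: "bracketL_vt a (pure2 b c) = rtensor \<lbrace>a, b\<rbrace> c"
  unfolding bracketL_vt_def
  by (rule ext_pure2)
    (use tensor2_linear_param(1)[OF bracket_in] in
      \<open>auto simp: bilinear_map_def linear_fscale_iff linear_field_iff rtensor_def
        bracket_linear fscale_def\<close>)

lemma bracketR_vt_pure2: "bracketR_vt a (pure2 b c) = perm12 (ltensor b \<lbrace>a, c\<rbrace>)"
  unfolding bracketR_vt_def
  by (rule ext_pure2)
    (use tensor2_linear_param(3)[OF bracket_in] in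
      \<open>auto simp: bilinear_map_def linear_fscale_iff linear_field_iff perm12_ltensor
        bracket_linear fscale_def\<close>)

lemma bracketL_tv_pure2: "bracketL_tv (pure2 a b) c = perm23 (rtensor \<lbrace>a, c\<rbrace> b)"
  unfolding bracketL_tv_def
  by (rule ext_pure2)
    (use tensor2_linear_param(3)[OF bracket_in] in
      \<open>auto simp: bilinear_map_def linear_fscale_iff linear_field_iff perm23_rtensor
        bracket_linear fscale_def\<close>)

lemma bracketR_tv_pure2: "bracketR_tv (pure2 a b) c = ltensor a \<lbrace>b, c\<rbrace>"
  unfolding bracketR_tv_def
  by (rule ext_pure2)
    (use tensor2_linear_param(2)[OF bracket_in] in
      \<open>auto simp: bilinear_map_def linear_fscale_iff linear_field_iff ltensor_def
        bracket_linear fscale_def\<close>)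

end

locale lie_double_algebra = double_algebra +
  assumes skew: "\<lbrace>a, b\<rbrace> = - swap \<lbrace>b, a\<rbrace>"
    and jacobi: "bracketL_vt a \<lbrace>b, c\<rbrace> - perm12 (bracketR_vt b \<lbrace>a, c\<rbrace>) = bracketL_tv \<lbrace>a, b\<rbrace> c"

end

theory Submission
  imports Defs
begin

text \<open>
  For a linear form \<open>\<phi>\<close> and a vector \<open>a\<close> consider the operator
  \<open>T(\<phi>, a) b = (\<phi> \<otimes> id) \<lbrace>a, b\<rbrace>\<close>.  The skew-symmetry and the Jacobi identity give
  \<open>T(\<psi>, b) T(\<phi>, a) = T(\<psi> \<circ> T(\<phi>, a), b) + T(\<phi>, T(\<psi>, b) a)\<close>, which says that the operator \<open>R\<close> on
  \<open>End V\<close> mapping \<open>v \<mapsto> \<phi>(v) a\<close> to \<open>T(\<phi>, a)\<close> is a Rota-Baxter operator of weight \<open>0\<close>.  Its image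
  \<open>A\<close> is a subalgebra of \<open>End V\<close>, and \<open>A\<close>-invariant subspaces are ideals.  If there were no nonzero
  proper ideal, \<open>A\<close> would act irreducibly and hence contain the identity; but \<open>id = R(x)\<close> implies
  \<open>id = R(x) R(x) = R(R(x) x + x R(x)) = R(x) + R(x) = id + id\<close>.
\<close>

text \<open>Up to \<open>\<eta>\<close>-conversion these rules also match unapplied sums of tensors and would unfold them.\<close>

declare plus_fun_apply [simp del] zero_fun_apply [simp del]

section \<open>Irreducible algebras of linear operators\<close>

context vector_space
begin

text \<open>
  If \<open>f\<close> is the identity on \<open>S\<close>, then \<open>g \<circ> f - g\<close> kills \<open>S\<close> for every \<open>g\<close> in \<open>A\<close>.  Hence either
  the annihilator of \<open>S\<close> moves \<open>v\<close> to any prescribed vector, or \<open>f v - v\<close> is killed by \<open>A\<close>.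
\<close>

lemma irreducible_fixes_finite_set:
  assumes lin: "\<And>f. f \<in> A \<Longrightarrow> Vector_Spaces.linear scale scale f"
    and zero: "(\<lambda>_. 0) \<in> A"
    and add: "\<And>f g. f \<in> A \<Longrightarrow> g \<in> A \<Longrightarrow> (\<lambda>x. f x + g x) \<in> A"
    and scl: "\<And>c f. f \<in> A \<Longrightarrow> (\<lambda>x. scale c (f x)) \<in> A"
    and comp: "\<And>f g. f \<in> A \<Longrightarrow> g \<in> A \<Longrightarrow> (\<lambda>x. f (g x)) \<in> A"
    and irr: "\<And>I. subspace I \<Longrightarrow> (\<And>f x. f \<in> A \<Longrightarrow> x \<in> I \<Longrightarrow> f x \<in> I) \<Longrightarrow> I = {0} \<or> I = UNIV"
    and nondeg: "\<And>v. (\<And>f. f \<in> A \<Longrightarrow> f v = 0) \<Longrightarrow> v = 0"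
    and "finite S"
  shows "\<exists>f\<in>A. \<forall>v\<in>S. f v = v"
  using \<open>finite S\<close>
proof (induction S)
  case empty
  show ?case using zero by auto
next
  case (insert v S)
  then obtain f where f: "f \<in> A" "\<And>w. w \<in> S \<Longrightarrow> f w = w" by blast
  have lin_rules: "h (x + y) = h x + h y" "h (scale c x) = scale c (h x)" if "h \<in> A" for h x y c
    using lin[OF that] by (auto simp: Vector_Spaces.linear_iff)
  \<comment> \<open>\<open>L\<close> absorbs composition with elements of \<open>A\<close> from the
    left, so the set \<open>I\<close> of values of \<open>L\<close> at \<open>v\<close> is invariant
    and \<open>irr\<close> applies to it.\<close>
  define L where "L = {g \<in> A. \<forall>w\<in>S. g w = 0}"
  define I where "I = (\<lambda>g. g v) ` L"
  have "subspace I"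
    unfolding subspace_def
  proof (intro conjI ballI allI)
    have "(\<lambda>_. 0) \<in> L" using zero by (simp add: L_def)
    then show "0 \<in> I" unfolding I_def by force
  next
    fix x y assume "x \<in> I" "y \<in> I"
    then obtain g h where "g \<in> L" "h \<in> L" "x = g v" "y = h v" by (auto simp: I_def)
    moreover from this have "(\<lambda>z. g z + h z) \<in> L" using add by (auto simp: L_def)
    ultimately show "x + y \<in> I" unfolding I_def by force
  next
    fix c x assume "x \<in> I"
    then obtain g where "g \<in> L" "x = g v" by (auto simp: I_def)
    moreover from this have "(\<lambda>z. scale c (g z)) \<in> L" using scl by (auto simp: L_def)
    ultimately show "scale c x \<in> I" unfolding I_def by force
  qed
  moreover have "h x \<in> I" if h: "h \<in> A" and x: "x \<in> I" for h x
  proof -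
    obtain g where g: "g \<in> L" "x = g v" using x by (auto simp: I_def)
    have "h 0 = 0" using lin_rules(2)[OF h, of 0 0] by simp
    then have "(\<lambda>z. h (g z)) \<in> L" using g comp[OF h] by (auto simp: L_def)
    then show ?thesis using g unfolding I_def by force
  qed
  ultimately have "I = {0} \<or> I = UNIV" by (rule irr)
  then consider "I = {0}" | "I = UNIV" by (elim disjE)
  then show ?case
  proof cases
    case 1
    have "f v - v = 0"
    proof (rule nondeg)
      fix g assume g: "g \<in> A"
      \<comment> \<open>This is g \<circ> f - g, which vanishes on \<open>S\<close> because
        \<open>f\<close> is the identity there. The factor -1 expresses the difference through
        \<open>add\<close> and \<open>scl\<close>.\<close>
      have "(\<lambda>x. g (f x) + scale (-1) (g x)) \<in> L"
        using add[OF comp[OF g f(1)] scl[OF g, of "-1"]] f(2) by (simp add: L_def)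
      then have "g (f v) + scale (-1) (g v) \<in> I"
        unfolding I_def by (rule rev_image_eqI) simp
      then have "g (f v) + scale (-1) (g v) = 0" using 1 by simp
      moreover have "g (f v + scale (-1) v) = g (f v) + scale (-1) (g v)"
        by (simp only: lin_rules[OF g])
      ultimately show "g (f v - v) = 0" by simp
    qed
    with f show ?thesis by auto
  next
    case 2
    then have "v - f v \<in> I" by simp
    \<comment> \<open>Adding \<open>g\<close> corrects the value of \<open>f\<close> at
      \<open>v\<close> and changes nothing on \<open>S\<close>.\<close>
    then obtain g where g: "g \<in> L" "g v = v - f v" by (auto simp: I_def)
    have "(\<lambda>x. f x + g x) \<in> A" using add f g by (simp add: L_def)
    moreover have "\<forall>w\<in>insert v S. f w + g w = w" using f g by (auto simp: L_def)
    ultimately show ?thesis by (intro bexI[of _ "\<lambda>x. f x + g x"])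
  qed
qed

end

section \<open>Contraction of tensors with linear forms\<close>

context tensor_powers
begin

lemma tensor2_induct [consumes 1, case_names zero step]:
  assumes "u \<in> tensor2" "P 0"
    and "\<And>c x y u. P u \<Longrightarrow> P (fscale c (pure2 x y) + u)"
  shows "P u"
proof -
  interpret F: vector_space "fscale :: 'a \<Rightarrow> (('b \<Rightarrow> 'b \<Rightarrow> 'a) \<Rightarrow> 'a) \<Rightarrow> _"
    by (rule vector_space_fscale)
  from assms(1) show ?thesis
    unfolding tensor_set_def
    by (induction rule: F.span_induct_alt) (use assms(2,3) in auto)
qed

lemma linear_from_fscale:
  assumes "Vector_Spaces.linear fscale scale g"
  shows "g (u + v) = g u + g v" "g (fscale c u) = c *s g u" "g 0 = 0"
    "g (- u) = - g u" "g (u - v) = g u - g v"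
proof -
  interpret Vector_Spaces.linear fscale scale g by (rule assms)
  show "g (u + v) = g u + g v" "g (fscale c u) = c *s g u" "g 0 = 0"
    "g (- u) = - g u" "g (u - v) = g u - g v"
    by (rule add scale zero neg diff)+
qed

lemma tensor_ops_zero:
  "swap 0 = 0" "perm12 0 = 0" "perm23 0 = 0" "rtensor 0 c = 0" "ltensor c 0 = 0" "ext f 0 = 0"
  by (auto simp: swap_def perm12_def perm23_def rtensor_def ltensor_def ext_def zero_fun_def)

text \<open>This is \<phi> \<otimes> id. The universal property supplies a map that is linear on the
  whole space of functionals, so its linearity rules ask for no membership in
  \<open>tensor2\<close>; outside \<open>tensor2\<close> its values are an arbitrary choice.\<close>

definition contraction :: "('b \<Rightarrow> 'a) \<Rightarrow> (('b \<Rightarrow> 'b \<Rightarrow> 'a) \<Rightarrow> 'a) \<Rightarrow> 'b" where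
  "contraction \<phi> = (SOME g. Vector_Spaces.linear fscale scale g \<and>
     (\<forall>v w. g (pure2 v w) = \<phi> v *s w))"

text \<open>This is \<phi> \<otimes> \<psi> \<otimes> id, to be applied to the Jacobi
  identity.\<close>

definition contraction3 ::
  "('b \<Rightarrow> 'a) \<Rightarrow> ('b \<Rightarrow> 'a) \<Rightarrow> (('b \<Rightarrow> 'b \<Rightarrow> 'b \<Rightarrow> 'a) \<Rightarrow> 'a) \<Rightarrow> 'b" where
  "contraction3 \<phi> \<psi> = (SOME g. Vector_Spaces.linear fscale scale g \<and>
     (\<forall>u v w. g (pure3 u v w) = (\<phi> u * \<psi> v) *s w))"

abbreviation form :: "('b \<Rightarrow> 'a) \<Rightarrow> bool" where
  "form \<phi> \<equiv> Vector_Spaces.linear scale (*) \<phi>"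

lemma contraction:
  assumes "form \<phi>"
  shows linear_contraction: "Vector_Spaces.linear fscale scale (contraction \<phi>)"
    and contraction_pure2: "contraction \<phi> (pure2 v w) = \<phi> v *s w"
proof -
  have "bilinear_map scale (\<lambda>v w. \<phi> v *s w)"
    using assms vector_space_axioms
    by (auto simp: bilinear_map_def linear_field_iff Vector_Spaces.linear_iff algebra_simps)
  from someI_ex[OF tensor2_universal[OF vector_space_axioms this]]
  show "Vector_Spaces.linear fscale scale (contraction \<phi>)"
    "contraction \<phi> (pure2 v w) = \<phi> v *s w"
    unfolding contraction_def by blast+
qed

lemma contraction3:
  assumes "form \<phi>" "form \<psi>"
  shows linear_contraction3: "Vector_Spaces.linear fscale scale (contraction3 \<phi> \<psi>)"
    and contraction3_pure3: "contraction3 \<phi> \<psi> (pure3 u v w) = (\<phi> u * \<psi> v) *s w"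
proof -
  have "trilinear_map scale (\<lambda>u v w. (\<phi> u * \<psi> v) *s w)"
    using assms vector_space_axioms
    by (auto simp: trilinear_map_def linear_field_iff Vector_Spaces.linear_iff algebra_simps)
  from someI_ex[OF tensor3_universal[OF vector_space_axioms this]]
  show "Vector_Spaces.linear fscale scale (contraction3 \<phi> \<psi>)"
    "contraction3 \<phi> \<psi> (pure3 u v w) = (\<phi> u * \<psi> v) *s w"
    unfolding contraction3_def by blast+
qed

lemmas contraction_rules = linear_from_fscale[OF linear_contraction] contraction_pure2
lemmas contraction3_rules = linear_from_fscale[OF linear_contraction3] contraction3_pure3

lemma form_zero: "form (\<lambda>_. 0)"
  by (simp add: linear_field_iff)

lemma form_add: "form \<phi> \<Longrightarrow> form \<psi> \<Longrightarrow> form (\<lambda>x. \<phi> x + \<psi> x)"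
  by (simp add: linear_field_iff algebra_simps)

lemma form_rules:
  assumes "form \<phi>"
  shows "\<phi> (x + y) = \<phi> x + \<phi> y" "\<phi> (c *s x) = c * \<phi> x" "\<phi> 0 = 0"
proof -
  show *: "\<phi> (x + y) = \<phi> x + \<phi> y" "\<phi> (c *s x) = c * \<phi> x" for x y c
    using assms by (auto simp: linear_field_iff)
  show "\<phi> 0 = 0" using *(2)[of 0 0] by simp
qed

text \<open>The choice in \<open>contraction\<close> is made for each form separately, so its
  dependence on the form is controlled only on the span of the pure tensors. The same holds for sums
  of forms below.\<close>

lemma contraction_zero_form: "u \<in> tensor2 \<Longrightarrow> contraction (\<lambda>_. 0) u = 0"
  by (induction rule: tensor2_induct) (simp_all add: contraction_rules form_zero)

lemma contraction_add_form:
  assumes "u \<in> tensor2" "form \<phi>" "form \<psi>"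
  shows "contraction (\<lambda>x. \<phi> x + \<psi> x) u = contraction \<phi> u + contraction \<psi> u"
  using assms(1)
  by (induction rule: tensor2_induct)
    (simp_all add: contraction_rules assms form_add algebra_simps)

lemma contraction3_rtensor:
  assumes "u \<in> tensor2" and \<phi>: "form \<phi>" and \<psi>: "form \<psi>"
  shows "contraction3 \<phi> \<psi> (rtensor u c) = \<psi> (contraction \<phi> u) *s c"
  using assms(1)
  by (induction rule: tensor2_induct)
    (simp_all add: tensor_ops_zero tensor_ops_add tensor_ops_scale rtensor_pure2
      contraction_rules contraction3_rules assms form_rules[OF \<psi>] algebra_simps)

text \<open>One \<open>perm12\<close> stems from \<open>bracketR_vt\<close>, the other from
  \<open>jacobi\<close>. They cancel, so \<open>\<phi>\<close> meets \<open>b\<close> and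
  \<open>\<psi>\<close> meets the first factor of \<open>u\<close>.\<close>

lemma contraction3_perm_ltensor:
  assumes "u \<in> tensor2" and \<phi>: "form \<phi>" and \<psi>: "form \<psi>"
  shows "contraction3 \<phi> \<psi> (perm12 (perm12 (ltensor b u))) = \<phi> b *s contraction \<psi> u"
  using assms(1)
  by (induction rule: tensor2_induct)
    (simp_all add: tensor_ops_zero tensor_ops_add tensor_ops_scale ltensor_pure2 perm12_pure3
      contraction_rules contraction3_rules assms algebra_simps)

text \<open>The permutation, which stems from \<open>bracketL_tv\<close>, puts \<open>b\<close> in
  the middle, where \<open>\<psi>\<close> evaluates it.\<close>

lemma contraction3_perm_rtensor:
  assumes "u \<in> tensor2" and \<phi>: "form \<phi>" and \<psi>: "form \<psi>"
  shows "contraction3 \<phi> \<psi> (perm23 (rtensor u b)) = \<psi> b *s contraction \<phi> u"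
  using assms(1)
  by (induction rule: tensor2_induct)
    (simp_all add: tensor_ops_zero tensor_ops_add tensor_ops_scale rtensor_pure2 perm23_pure3
      contraction_rules contraction3_rules assms algebra_simps)

lemma swap_tensor_set:
  assumes "u \<in> tensor_set I J"
  shows "swap u \<in> tensor_set J I"
proof -
  interpret F: vector_space "fscale :: 'a \<Rightarrow> (('b \<Rightarrow> 'b \<Rightarrow> 'a) \<Rightarrow> 'a) \<Rightarrow> _"
    by (rule vector_space_fscale)
  show ?thesis
    using assms unfolding tensor_set_def
  proof (induction rule: F.span_induct_alt)
    case base
    show ?case by (simp add: tensor_ops_zero F.span_zero)
  next
    case (step c p u)
    then obtain v w where "p = pure2 v w" "v \<in> I" "w \<in> J" by blast
    then have "swap p \<in> {pure2 v w | v w. v \<in> J \<and> w \<in> I}" by (auto simp: swap_pure2)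
    then show ?case
      unfolding tensor_ops_add tensor_ops_scale
      by (intro F.span_add F.span_scale F.span_base step)
  qed
qed

text \<open>Expanding the first factor in \<open>Basis\<close> writes \<open>u\<close> as the sum of
  \<open>pure2 e (contraction (?r e) u)\<close>, where \<open>?r e\<close> is the coordinate form of
  \<open>e\<close>; all second factors then lie in \<open>I\<close>.\<close>

lemma contraction_in_imp_tensor_set:
  assumes fd: "finite_dimensional_vector_space scale Basis" and u: "u \<in> tensor2"
    and I: "\<And>\<phi>. form \<phi> \<Longrightarrow> contraction \<phi> u \<in> I"
  shows "u \<in> tensor_set UNIV I"
proof -
  interpret finite_dimensional_vector_space scale Basis by (rule fd)
  interpret F: vector_space "fscale :: 'a \<Rightarrow> (('b \<Rightarrow> 'b \<Rightarrow> 'a) \<Rightarrow> 'a) \<Rightarrow> _"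
    by (rule vector_space_fscale)
  let ?r = "\<lambda>e v. representation Basis v e"
  have form_r: "form (?r e)" for e
    by (simp add: linear_field_iff representation_add representation_scale independent_Basis
        span_Basis)
  have pl: "pure2 (x + y) z = pure2 x z + pure2 y z" "pure2 z (x + y) = pure2 z x + pure2 z y"
    "pure2 (c *s x) z = fscale c (pure2 x z)" "pure2 z (c *s x) = fscale c (pure2 z x)"
    for x y z c
    using bilinear_pure2 by (auto simp: bilinear_map_def Vector_Spaces.linear_iff)
  have pure2_zero: "pure2 0 z = 0" "pure2 z 0 = 0" for z
    using pl(1)[of 0 0 z] pl(2)[of z 0 0] by simp_all
  have pure2_sum: "pure2 (\<Sum>e\<in>B. c e *s e) z = (\<Sum>e\<in>B. fscale (c e) (pure2 e z))" for B c z
    by (induction B rule: infinite_finite_induct) (simp_all add: pl pure2_zero)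
  have "u = (\<Sum>e\<in>Basis. pure2 e (contraction (?r e) u))"
    using u
  proof (induction rule: tensor2_induct)
    case zero
    show ?case by (simp add: contraction_rules form_r pure2_zero)
  next
    case (step c x y u)
    have "pure2 x y = pure2 (\<Sum>e\<in>Basis. ?r e x *s e) y"
      by (simp add: sum_representation_eq independent_Basis span_Basis finite_Basis)
    then have "pure2 x y = (\<Sum>e\<in>Basis. fscale (?r e x) (pure2 e y))"
      by (simp add: pure2_sum)
    then have "fscale c (pure2 x y) + u =
        fscale c (\<Sum>e\<in>Basis. fscale (?r e x) (pure2 e y)) +
        (\<Sum>e\<in>Basis. pure2 e (contraction (?r e) u))"
      using step by simp
    also have "\<dots> = (\<Sum>e\<in>Basis. pure2 e (contraction (?r e) (fscale c (pure2 x y) + u)))"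
      by (simp add: contraction_rules form_r pl F.scale_sum_right sum.distrib del: F.scale_scale
          scale_scale)
    finally show ?case .
  qed
  also have "\<dots> \<in> tensor_set UNIV I"
    unfolding tensor_set_def using I[OF form_r] by (intro F.span_sum F.span_base) blast
  finally show ?thesis .
qed

end

section \<open>The operators \<open>T\<close> and their sums\<close>

context double_algebra
begin

definition T :: "('v \<Rightarrow> 'k) \<Rightarrow> 'v \<Rightarrow> 'v \<Rightarrow> 'v" where
  "T \<phi> a b = contraction \<phi> \<lbrace>a, b\<rbrace>"

lemma T_linear:
  assumes "form \<phi>"
  shows "T \<phi> (a + a') b = T \<phi> a b + T \<phi> a' b" "T \<phi> (scale c a) b = scale c (T \<phi> a b)"
    "T \<phi> a (b + b') = T \<phi> a b + T \<phi> a b'" "T \<phi> a (scale c b) = scale c (T \<phi> a b)"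
    "T \<phi> 0 b = 0" "T \<phi> a 0 = 0" "T \<phi> (- a) b = - T \<phi> a b"
proof -
  show *: "T \<phi> (a + a') b = T \<phi> a b + T \<phi> a' b" "T \<phi> (scale c a) b = scale c (T \<phi> a b)"
    "T \<phi> a (b + b') = T \<phi> a b + T \<phi> a b'" "T \<phi> a (scale c b) = scale c (T \<phi> a b)"
    for c a a' b b'
    by (simp_all add: T_def bracket_linear contraction_rules assms)
  show "T \<phi> 0 b = 0" "T \<phi> a 0 = 0" "T \<phi> (- a) b = - T \<phi> a b"
    using *(2)[of 0 0 b] *(4)[of a 0 0] *(2)[of "-1" a b] by simp_all
qed

lemma T_form:
  "form \<phi> \<Longrightarrow> form \<psi> \<Longrightarrow> T (\<lambda>x. \<phi> x + \<psi> x) a b = T \<phi> a b + T \<psi> a b"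
  "T (\<lambda>_. 0) a b = 0"
  by (simp_all add: T_def contraction_add_form contraction_zero_form bracket_in)

text \<open>A list of pairs \<open>(\<phi>, a)\<close> stands for the sum of the rank-one operators \<open>v \<mapsto> \<phi>(v) a\<close>.\<close>

fun R :: "(('v \<Rightarrow> 'k) \<times> 'v) list \<Rightarrow> 'v \<Rightarrow> 'v" where
  "R [] v = 0"
| "R ((\<phi>, a) # P) v = T \<phi> a v + R P v"

abbreviation forms :: "(('v \<Rightarrow> 'k) \<times> 'v) list \<Rightarrow> bool" where
  "forms P \<equiv> \<forall>p\<in>set P. form (fst p)"

lemma R_append: "R (P @ Q) v = R P v + R Q v"
  by (induction P) (auto simp: algebra_simps)

lemma R_linear:
  assumes "forms P"
  shows "R P (x + y) = R P x + R P y" "R P (scale c x) = scale c (R P x)" "R P 0 = 0"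
  using assms by (induction P) (auto simp: T_linear algebra_simps)

lemma R_scale: "forms P \<Longrightarrow> R (map (\<lambda>(\<phi>, a). (\<phi>, scale c a)) P) v = scale c (R P v)"
  by (induction P) (auto simp: T_linear algebra_simps)

lemma form_comp_R: "form \<psi> \<Longrightarrow> forms P \<Longrightarrow> form (\<lambda>x. \<psi> (R P x))"
  by (simp add: linear_field_iff R_linear)

lemma form_comp_T: "form \<psi> \<Longrightarrow> form \<phi> \<Longrightarrow> form (\<lambda>x. \<psi> (T \<phi> a x))"
  by (simp add: linear_field_iff T_linear)

end

section \<open>The Rota-Baxter identity and the existence of an ideal\<close>

context lie_double_algebra
begin

text \<open>Apply \<phi> \<otimes> \<psi> \<otimes> id to \<open>jacobi\<close>. The facts 1, 2 and
  3 evaluate its three terms with an arbitrary tensor in place of the inner bracket, which reduces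
  them to pure tensors.\<close>

lemma T_comp:
  assumes \<phi>: "form \<phi>" and \<psi>: "form \<psi>"
  shows "T \<psi> b (T \<phi> a c) = T (\<lambda>x. \<psi> (T \<phi> a x)) b c + T \<phi> (T \<psi> b a) c"
proof -
  note rules = tensor_ops_zero tensor_ops_add tensor_ops_scale contraction_rules
    contraction3_rules T_linear \<phi> \<psi>
  have 1: "contraction3 \<phi> \<psi> (bracketL_vt a u) = contraction (\<lambda>x. \<psi> (T \<phi> a x)) u"
    if "u \<in> tensor2" for u
    using that
  proof (induction rule: tensor2_induct)
    case zero
    show ?case by (simp add: bracketL_vt_def rules form_comp_T)
  next
    case (step c x y u)
    have "contraction3 \<phi> \<psi> (bracketL_vt a (pure2 x y)) = scale (\<psi> (T \<phi> a x)) y"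
      by (simp add: bracketL_vt_pure2 contraction3_rtensor[OF bracket_in \<phi> \<psi>] T_def)
    with step show ?case by (simp add: bracketL_vt_def rules form_comp_T)
  qed
  have 2: "contraction3 \<phi> \<psi> (perm12 (bracketR_vt b u)) = T \<psi> b (contraction \<phi> u)"
    if "u \<in> tensor2" for u
    using that
  proof (induction rule: tensor2_induct)
    case zero
    show ?case by (simp add: bracketR_vt_def rules)
  next
    case (step c x y u)
    have "contraction3 \<phi> \<psi> (perm12 (bracketR_vt b (pure2 x y))) = scale (\<phi> x) (T \<psi> b y)"
      by (simp add: bracketR_vt_pure2 contraction3_perm_ltensor[OF bracket_in \<phi> \<psi>] T_def)
    with step show ?case by (simp add: bracketR_vt_def rules)
  qed
  \<comment> \<open>Here \<open>\<psi>\<close> falls on the second factor of \<open>u\<close>,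
    whereas \<open>contraction\<close> acts on the first. The \<open>swap\<close> is removed by
    \<open>skew\<close>, which brings in a sign.\<close>
  have 3: "contraction3 \<phi> \<psi> (bracketL_tv u c) = T \<phi> (contraction \<psi> (swap u)) c"
    if "u \<in> tensor2" for u
    using that
  proof (induction rule: tensor2_induct)
    case zero
    show ?case by (simp add: bracketL_tv_def rules)
  next
    case (step d x y u)
    have "contraction3 \<phi> \<psi> (bracketL_tv (pure2 x y) c) = scale (\<psi> y) (T \<phi> x c)"
      by (simp add: bracketL_tv_pure2 contraction3_perm_rtensor[OF bracket_in \<phi> \<psi>] T_def)
    with step show ?case by (simp add: bracketL_tv_def swap_pure2 rules)
  qed
  have "contraction3 \<phi> \<psi> (bracketL_tv \<lbrace>a, b\<rbrace> c) = - T \<phi> (T \<psi> b a) c"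
  proof -
    have "swap \<lbrace>a, b\<rbrace> = - \<lbrace>b, a\<rbrace>" using skew[of b a] by simp
    then show ?thesis by (simp add: 3 bracket_in rules T_def[of \<psi> b a])
  qed
  moreover have "contraction3 \<phi> \<psi> (bracketL_vt a \<lbrace>b, c\<rbrace>) = T (\<lambda>x. \<psi> (T \<phi> a x)) b c"
    by (simp add: 1 bracket_in T_def[of _ b c])
  moreover have "contraction3 \<phi> \<psi> (perm12 (bracketR_vt b \<lbrace>a, c\<rbrace>)) = T \<psi> b (T \<phi> a c)"
    by (simp add: 2 bracket_in T_def[of _ a c])
  ultimately have "T (\<lambda>x. \<psi> (T \<phi> a x)) b c - T \<psi> b (T \<phi> a c) = - T \<phi> (T \<psi> b a) c"
    using jacobi[of a b c] by (metis contraction3_rules(5)[OF \<phi> \<psi>])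
  then show ?thesis by (simp add: algebra_simps)
qed

text \<open>The Rota-Baxter identity with a rank-one left argument: \<open>T_comp\<close> summed
  over the pairs in \<open>Q\<close>.\<close>

lemma T_comp_R:
  assumes "form \<psi>" "forms Q"
  shows "T \<psi> b (R Q c) = T (\<lambda>x. \<psi> (R Q x)) b c + R (map (\<lambda>(\<phi>, a). (\<phi>, T \<psi> b a)) Q) c"
  using assms(2)
proof (induction Q)
  case Nil
  show ?case using assms(1) by (simp add: form_rules T_linear T_form)
next
  case (Cons p Q)
  obtain \<phi> a where p: "p = (\<phi>, a)" by fastforce
  with Cons assms(1) show ?case
    by (simp add: form_rules(1)[OF assms(1)] T_linear T_form T_comp form_comp_T form_comp_R
        algebra_simps)
qed

text \<open>The Rota-Baxter identity \<open>R(x) R(y) = R(x R(y)) + R(R(x) y)\<close>.\<close>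

lemma R_comp_R:
  assumes "forms P" "forms Q"
  shows "R P (R Q c) =
    R (map (\<lambda>(\<psi>, b). (\<lambda>x. \<psi> (R Q x), b)) P @ map (\<lambda>(\<phi>, a). (\<phi>, R P a)) Q) c"
proof -
  \<comment> \<open>For the induction on \<open>P\<close>: the vectors \<open>R P a\<close> are 0
    when \<open>P\<close> is empty and split into two summands when a pair is put in front of
    \<open>P\<close>.\<close>
  have zero: "R (map (\<lambda>(\<phi>, a). (\<phi>, 0)) Q) c = 0"
    using assms(2) by (induction Q) (auto simp: T_linear)
  have add: "R (map (\<lambda>(\<phi>, a). (\<phi>, f a + g a)) Q) c =
      R (map (\<lambda>(\<phi>, a). (\<phi>, f a)) Q) c + R (map (\<lambda>(\<phi>, a). (\<phi>, g a)) Q) c" for f g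
    using assms(2) by (induction Q) (auto simp: T_linear algebra_simps)
  show ?thesis
    using assms(1) by (induction P) (auto simp: zero add T_comp_R assms(2) R_append)
qed

text \<open>Invariance says that for \<open>w\<close> in \<open>I\<close> every contraction of
  \<open>\<lbrace>v, w\<rbrace>\<close> lies in \<open>I\<close>, which places the bracket in V
  \<otimes> I. For \<open>v\<close> in \<open>I\<close>, skew-symmetry places it in I \<otimes>
  V.\<close>

lemma invariant_imp_double_ideal:
  assumes fd: "finite_dimensional_vector_space scale Basis" and I: "subspace I"
    and inv: "\<And>\<phi> a b. form \<phi> \<Longrightarrow> b \<in> I \<Longrightarrow> T \<phi> a b \<in> I"
  shows "double_ideal I"
proof -
  interpret F: vector_space "fscale :: 'a \<Rightarrow> (('b \<Rightarrow> 'b \<Rightarrow> 'a) \<Rightarrow> 'a) \<Rightarrow> _"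
    by (rule vector_space_fscale)
  have zero: "0 \<in> tensor_set J K" for J K
    unfolding tensor_set_def by (rule F.span_zero)
  have right: "\<lbrace>v, w\<rbrace> \<in> tensor_set UNIV I" if "w \<in> I" for v w
    using inv that by (intro contraction_in_imp_tensor_set[OF fd bracket_in]) (simp add: T_def)
  have left: "\<lbrace>v, w\<rbrace> \<in> tensor_set I UNIV" if "v \<in> I" for v w
  proof -
    have "- swap \<lbrace>w, v\<rbrace> \<in> tensor_set I UNIV"
      using swap_tensor_set[OF right[OF that, of w]] unfolding tensor_set_def by (rule F.span_neg)
    then show ?thesis using skew[of v w] by simp
  qed
  have "\<exists>p q. \<lbrace>v, w\<rbrace> = p + q \<and> p \<in> tensor_set I UNIV \<and> q \<in> tensor_set UNIV I"
    if "v \<in> I \<or> w \<in> I" for v w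
    using that
  proof
    assume "v \<in> I"
    then show ?thesis
      using left zero by (intro exI[of _ "\<lbrace>v, w\<rbrace>"] exI[of _ 0]) simp
  next
    assume "w \<in> I"
    then show ?thesis
      using right zero by (intro exI[of _ 0] exI[of _ "\<lbrace>v, w\<rbrace>"]) simp
  qed
  with I show ?thesis unfolding double_ideal_def by blast
qed

text \<open>If \<open>R P\<close> is the identity, both lists in \<open>R_comp_R\<close> for
  \<open>P\<close> and \<open>P\<close> reduce to \<open>P\<close>, so v = v + v.\<close>

lemma R_not_identity:
  assumes "forms P" "\<And>x. R P x = x"
  shows "(v :: 'b) = 0"
  using R_comp_R[OF assms(1,1), of v] by (simp add: assms(2) R_append case_prod_eta)

lemma exists_double_ideal:
  assumes fd: "finite_dimensional_vector_space scale Basis" and dim: "dim (UNIV :: 'b set) > 1"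
  shows "\<exists>I. double_ideal I \<and> I \<noteq> {0} \<and> I \<noteq> UNIV"
proof (rule ccontr)
  assume no: "\<not> ?thesis"
  interpret finite_dimensional_vector_space scale Basis by (rule fd)
  have nonzero: "\<exists>v :: 'b. v \<noteq> 0"
  proof (rule ccontr)
    assume "\<not> ?thesis"
    then have "(UNIV :: 'b set) \<subseteq> {0}" by auto
    then have "dim (UNIV :: 'b set) = 0" by (simp only: dim_eq_0)
    with dim show False by simp
  qed
  \<comment> \<open>The image of the Rota-Baxter operator. Concatenating lists gives closure under
    sums, and \<open>R_comp_R\<close> gives closure under composition.\<close>
  define A where "A = {f. \<exists>P. forms P \<and> f = R P}"
  have A_R: "R P \<in> A" if "forms P" for P
    using that by (auto simp: A_def)
  have T_A: "T \<phi> a \<in> A" if "form \<phi>" for \<phi> a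
  proof -
    have "R [(\<phi>, a)] = T \<phi> a" by (rule HOL.ext) simp
    then show ?thesis using A_R[of "[(\<phi>, a)]"] that by simp
  qed
  have irr: "I = {0} \<or> I = UNIV"
    if "subspace I" "\<And>f x. f \<in> A \<Longrightarrow> x \<in> I \<Longrightarrow> f x \<in> I" for I
    using no invariant_imp_double_ideal[OF fd that(1)] T_A that(2) by blast
  have lin: "f (x + y) = f x + f y" "f (scale c x) = scale c (f x)" if "f \<in> A" for f x y c
    using that by (auto simp: A_def R_linear)
  have zero: "(\<lambda>_. 0) \<in> A"
  proof -
    have "R [] = (\<lambda>_. 0)" by (rule HOL.ext) simp
    then show ?thesis using A_R[of "[]"] by simp
  qed
  have add: "(\<lambda>x. f x + g x) \<in> A" if fg: "f \<in> A" "g \<in> A" for f g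
  proof -
    obtain P Q where "forms P" "forms Q" "f = R P" "g = R Q" using fg by (auto simp: A_def)
    then have "R (P @ Q) \<in> A" by (intro A_R) auto
    moreover have "R (P @ Q) = (\<lambda>x. R P x + R Q x)" by (rule HOL.ext) (rule R_append)
    ultimately show ?thesis using \<open>f = R P\<close> \<open>g = R Q\<close> by simp
  qed
  have scl: "(\<lambda>x. scale c (f x)) \<in> A" if f: "f \<in> A" for f c
  proof -
    obtain P where P: "forms P" "f = R P" using f by (auto simp: A_def)
    have "R (map (\<lambda>(\<phi>, a). (\<phi>, scale c a)) P) \<in> A" using P by (intro A_R) auto
    moreover have "R (map (\<lambda>(\<phi>, a). (\<phi>, scale c a)) P) = (\<lambda>x. scale c (f x))"
      using P by (intro HOL.ext) (simp add: R_scale)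
    ultimately show ?thesis by simp
  qed
  have comp: "(\<lambda>x. f (g x)) \<in> A" if fg: "f \<in> A" "g \<in> A" for f g
  proof -
    obtain P Q where PQ: "forms P" "forms Q" "f = R P" "g = R Q" using fg by (auto simp: A_def)
    then have "forms (map (\<lambda>(\<psi>, b). (\<lambda>x. \<psi> (R Q x), b)) P @ map (\<lambda>(\<phi>, a). (\<phi>, R P a)) Q)"
      by (auto simp: form_comp_R)
    note A_R[OF this]
    also have "R (map (\<lambda>(\<psi>, b). (\<lambda>x. \<psi> (R Q x), b)) P @ map (\<lambda>(\<phi>, a). (\<phi>, R P a)) Q) =
        (\<lambda>x. f (g x))"
      by (rule HOL.ext) (simp only: PQ(3,4) R_comp_R[OF PQ(1,2)])
    finally show ?thesis .
  qed
  \<comment> \<open>The common kernel of \<open>A\<close> is invariant, hence zero or everything. If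
    it were everything, \<open>A\<close> would act by zero and every line would be invariant,
    against dimension above 1.\<close>
  define N where "N = {v. \<forall>f\<in>A. f v = 0}"
  have A_zero: "f 0 = 0" if "f \<in> A" for f
    using lin(2)[OF that, of 0 0] by simp
  have "subspace N"
    by (auto simp: subspace_def N_def lin A_zero)
  then have "N = {0} \<or> N = UNIV"
    by (rule irr) (auto simp: N_def A_zero)
  moreover have "N \<noteq> UNIV"
  proof
    assume N: "N = UNIV"
    have A_trivial: "f x = 0" if "f \<in> A" for f x
    proof -
      have "x \<in> N" using N by simp
      then show ?thesis using that by (simp add: N_def)
    qed
    obtain v :: 'b where v: "v \<noteq> 0"
      using nonzero by blast
    have "span {v} = {0} \<or> span {v} = UNIV"
      by (rule irr) (simp_all add: A_trivial span_zero)
    moreover have "span {v} \<noteq> {0}"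
      using v span_base[of v "{v}"] by auto
    ultimately have "dim (UNIV :: 'b set) \<le> card {v}"
      by (intro dim_le_card) auto
    with dim show False by simp
  qed
  ultimately have N: "N = {0}" by blast
  \<comment> \<open>\<open>Basis\<close> is finite and spans, so an element of \<open>A\<close> that
    fixes it pointwise is the identity.\<close>
  have "\<exists>f\<in>A. \<forall>v\<in>Basis. f v = v"
  proof (rule irreducible_fixes_finite_set)
    show "Vector_Spaces.linear scale scale f" if "f \<in> A" for f
      using lin[OF that] vector_space_axioms by (simp add: Vector_Spaces.linear_iff)
    show "v = 0" if "\<And>f. f \<in> A \<Longrightarrow> f v = 0" for v
      using that N by (auto simp: N_def)
  qed (use zero add scl comp irr finite_Basis in auto)
  then obtain f where f: "f \<in> A" "\<And>v. v \<in> Basis \<Longrightarrow> f v = v" by blast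
  have "f x = x" for x
  proof -
    have "x \<in> span Basis" by (simp add: span_Basis)
    then show ?thesis
      by (induction rule: span_induct_alt) (simp_all add: A_zero lin f)
  qed
  moreover obtain P where "forms P" "f = R P" using f(1) by (auto simp: A_def)
  ultimately have "v = 0" for v :: 'b using R_not_identity[of P v] by simp
  with nonzero show False by blast
qed

end

theorem theorem2:
  fixes scale :: "'k::field \<Rightarrow> 'v::ab_group_add \<Rightarrow> 'v"
    and br :: "(('v \<Rightarrow> 'v \<Rightarrow> 'k) \<Rightarrow> 'k) \<Rightarrow> ('v \<Rightarrow> 'v \<Rightarrow> 'k) \<Rightarrow> 'k"
  assumes "lie_double_algebra scale br"
    and "\<exists>Basis. finite_dimensional_vector_space scale Basis"
    and "vector_space.dim scale (UNIV :: 'v set) > 1"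
  shows "\<exists>I. double_algebra.double_ideal scale br I \<and> I \<noteq> {0} \<and> I \<noteq> UNIV"
  using assms lie_double_algebra.exists_double_ideal by blast

end
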